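(* The systems $\mathbb{LP}(\square)$ and $\mathbb{L}(\nabla)$ are deductively equivalent. That is, identifying the operators $\square$ and $\nabla$: for every formula $A$ of the language $L(\neg,\land,\lor,\to,\nabla)$, if $A^{\square}$ denotes the formula obtained from $A$ by replacing every occurrence of $\nabla$ by $\square$, then $\vdash_{\mathbb{L}(\nabla)} A$ if and only if $\vdash_{\mathbb{LP}(\square)} A^{\square}$.
   Context: Formulas are built from propositional variables $p_0,p_1,p_2,\dots$ with the connectives $\neg,\land,\lor,\to$ and one unary operator: $\nabla$ for $\mathbb{L}(\nabla)$, $\square$ for $\mathbb{LP}(\square)$. $A\leftrightarrow B$ abbreviates $(A\to B)\land(B\to A)$, and $\top$ abbreviates a fixed classical tautology such as $p_0\lor\neg p_0$. The propositional logic of the plausible $\mathbb{L}(\nabla)$ has as axioms all instances, in its language, of a complete axiomatization of classical propositional logic, together with all instances of - $(\nabla\varphi\land\nabla\psi)\to\nabla(\varphi\land\psi)$, - $\nabla(\varphi\lor\neg\varphi)$, - $\nabla\varphi\to\varphi$. Its rules are Modus Ponens and the rule: from $\vdash\varphi\to\psi$ infer $\vdash\nabla\varphi\to\nabla\psi$. The modal propositional logic of the plausible $\mathbb{LP}(\square)$ has as axioms all instances, in its language, of a complete axiomatization of classical propositional logic, together with all instances of - C: $\square A\land\square B\to\square(A\land B)$, - H: $\square A\lor\square B\to\square(A\lor B)$, - T: $\square A\to A$, - N: $\square\top$. Its rules are Modus Ponens and the rule RE: from $\vdash A\leftrightarrow B$ infer $\vdash\square A\leftrightarrow\square B$. In each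 system $\vdash A$ means that $A$ is a theorem, i.e. is obtained from the axioms by finitely many applications of the rules. *)

theory Defs
  imports Main
begin

section \<open>Classical propositional logic and its axiomatizations\<close>

datatype pform =
    PVar nat
  | PNeg pform
  | PConj pform pform
  | PDisj pform pform
  | PImp pform pform

primrec peval :: "(nat \<Rightarrow> bool) \<Rightarrow> pform \<Rightarrow> bool" where
  "peval v (PVar i) = v i"
| "peval v (PNeg A) = (\<not> peval v A)"
| "peval v (PConj A B) = (peval v A \<and> peval v B)"
| "peval v (PDisj A B) = (peval v A \<or> peval v B)"
| "peval v (PImp A B) = (peval v A \<longrightarrow> peval v B)"

definition ptautology :: "pform \<Rightarrow> bool" where
  "ptautology A \<longleftrightarrow> (\<forall>v. peval v A)"

primrec psubst :: "(nat \<Rightarrow> pform) \<Rightarrow> pform \<Rightarrow> pform" where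
  "psubst s (PVar i) = s i"
| "psubst s (PNeg A) = PNeg (psubst s A)"
| "psubst s (PConj A B) = PConj (psubst s A) (psubst s B)"
| "psubst s (PDisj A B) = PDisj (psubst s A) (psubst s B)"
| "psubst s (PImp A B) = PImp (psubst s A) (psubst s B)"

text \<open>
  A set \<open>Ax\<close> of formulas is read as a set of axiom schemata: the variables occurring in it are
  metavariables, and the axioms are all substitution instances. Modus Ponens is the only rule.
\<close>

inductive pderivable :: "pform set \<Rightarrow> pform \<Rightarrow> bool" for Ax :: "pform set" where
  Axiom: "S \<in> Ax \<Longrightarrow> pderivable Ax (psubst s S)"
| MP: "pderivable Ax (PImp A B) \<Longrightarrow> pderivable Ax A \<Longrightarrow> pderivable Ax B"

text \<open>
  The theorems must be exactly the tautologies: soundness is included, since an unsound set of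
  schemata does not axiomatize classical logic.
\<close>

definition complete_axiomatization :: "pform set \<Rightarrow> bool" where
  "complete_axiomatization Ax \<longleftrightarrow> (\<forall>A. pderivable Ax A \<longleftrightarrow> ptautology A)"

lemma peval_psubst: "peval v (psubst s A) = peval (\<lambda>i. peval v (s i)) A"
  by (induction A) auto

lemma psubst_PVar: "psubst PVar A = A"
  by (induction A) auto

lemma complete_axiomatization_tautologies: "complete_axiomatization {A. ptautology A}"
proof -
  have "ptautology A" if "pderivable {A. ptautology A} A" for A
    using that by induction (auto simp: ptautology_def peval_psubst)
  moreover have "pderivable {A. ptautology A} A" if "ptautology A" for A
    using pderivable.Axiom[of A "{A. ptautology A}" PVar] that by (simp add: psubst_PVar)
  ultimately show ?thesis
    unfolding complete_axiomatization_def by blast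
qed


section \<open>Formulas with one unary operator\<close>

text \<open>
  The type parameter is the type of operator symbols. The two languages instantiate it by two
  distinct one-element types, so they share the connectives but not the operator.
\<close>

datatype 'op form =
    Var nat
  | Neg "'op form"  (\<open>\<^bold>\<not> _\<close> [70] 70)
  | Conj "'op form" "'op form"  (infixr \<open>\<^bold>\<and>\<close> 65)
  | Disj "'op form" "'op form"  (infixr \<open>\<^bold>\<or>\<close> 60)
  | Imp "'op form" "'op form"  (infixr \<open>\<^bold>\<longrightarrow>\<close> 55)
  | Op 'op "'op form"

abbreviation Iff :: "'op form \<Rightarrow> 'op form \<Rightarrow> 'op form"  (infix \<open>\<^bold>\<longleftrightarrow>\<close> 50) where
  "A \<^bold>\<longleftrightarrow> B \<equiv> (A \<^bold>\<longrightarrow> B) \<^bold>\<and> (B \<^bold>\<longrightarrow> A)"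

abbreviation Top :: "'op form"  (\<open>\<^bold>\<top>\<close>) where
  "\<^bold>\<top> \<equiv> Var 0 \<^bold>\<or> \<^bold>\<not> Var 0"

datatype nabla = Nabla
datatype box = Box

type_synonym nabla_form = "nabla form"
type_synonym box_form = "box form"

abbreviation nabla_op :: "nabla_form \<Rightarrow> nabla_form"  (\<open>\<^bold>\<nabla> _\<close> [70] 70) where
  "\<^bold>\<nabla> A \<equiv> Op Nabla A"

abbreviation box_op :: "box_form \<Rightarrow> box_form"  (\<open>\<^bold>\<box> _\<close> [70] 70) where
  "\<^bold>\<box> A \<equiv> Op Box A"

text \<open>The instance of a propositional schema obtained by putting \<open>s i\<close> for its \<open>i\<close>-th metavariable:\<close>

primrec inst :: "(nat \<Rightarrow> 'op form) \<Rightarrow> pform \<Rightarrow> 'op form" where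
  "inst s (PVar i) = s i"
| "inst s (PNeg A) = \<^bold>\<not> inst s A"
| "inst s (PConj A B) = inst s A \<^bold>\<and> inst s B"
| "inst s (PDisj A B) = inst s A \<^bold>\<or> inst s B"
| "inst s (PImp A B) = inst s A \<^bold>\<longrightarrow> inst s B"


section \<open>The two systems\<close>

inductive L_nabla :: "pform set \<Rightarrow> nabla_form \<Rightarrow> bool" for Ax :: "pform set" where
  Prop: "S \<in> Ax \<Longrightarrow> L_nabla Ax (inst s S)"
| Conj: "L_nabla Ax ((\<^bold>\<nabla> A \<^bold>\<and> \<^bold>\<nabla> B) \<^bold>\<longrightarrow> \<^bold>\<nabla> (A \<^bold>\<and> B))"
| ExMid: "L_nabla Ax (\<^bold>\<nabla> (A \<^bold>\<or> \<^bold>\<not> A))"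
| Refl: "L_nabla Ax (\<^bold>\<nabla> A \<^bold>\<longrightarrow> A)"
| MP: "L_nabla Ax (A \<^bold>\<longrightarrow> B) \<Longrightarrow> L_nabla Ax A \<Longrightarrow> L_nabla Ax B"
| Mono: "L_nabla Ax (A \<^bold>\<longrightarrow> B) \<Longrightarrow> L_nabla Ax (\<^bold>\<nabla> A \<^bold>\<longrightarrow> \<^bold>\<nabla> B)"

inductive LP_box :: "pform set \<Rightarrow> box_form \<Rightarrow> bool" for Ax :: "pform set" where
  Prop: "S \<in> Ax \<Longrightarrow> LP_box Ax (inst s S)"
| C: "LP_box Ax ((\<^bold>\<box> A \<^bold>\<and> \<^bold>\<box> B) \<^bold>\<longrightarrow> \<^bold>\<box> (A \<^bold>\<and> B))"
| H: "LP_box Ax ((\<^bold>\<box> A \<^bold>\<or> \<^bold>\<box> B) \<^bold>\<longrightarrow> \<^bold>\<box> (A \<^bold>\<or> B))"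
| T: "LP_box Ax (\<^bold>\<box> A \<^bold>\<longrightarrow> A)"
| N: "LP_box Ax (\<^bold>\<box> \<^bold>\<top>)"
| MP: "LP_box Ax (A \<^bold>\<longrightarrow> B) \<Longrightarrow> LP_box Ax A \<Longrightarrow> LP_box Ax B"
| RE: "LP_box Ax (A \<^bold>\<longleftrightarrow> B) \<Longrightarrow> LP_box Ax (\<^bold>\<box> A \<^bold>\<longleftrightarrow> \<^bold>\<box> B)"

primrec nabla_to_box :: "nabla_form \<Rightarrow> box_form" where
  "nabla_to_box (Var i) = Var i"
| "nabla_to_box (\<^bold>\<not> A) = \<^bold>\<not> nabla_to_box A"
| "nabla_to_box (A \<^bold>\<and> B) = nabla_to_box A \<^bold>\<and> nabla_to_box B"
| "nabla_to_box (A \<^bold>\<or> B) = nabla_to_box A \<^bold>\<or> nabla_to_box B"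
| "nabla_to_box (A \<^bold>\<longrightarrow> B) = nabla_to_box A \<^bold>\<longrightarrow> nabla_to_box B"
| "nabla_to_box (Op x A) = \<^bold>\<box> nabla_to_box A"

end

theory Submission
  imports Defs
begin

text \<open>
  Apart from the propositional base, the two systems differ in that one has monotonicity of the
  operator as a rule, while the other has only replacement of equivalents (RE) together with the
  distribution axiom H. Classically these amount to the same. Monotonicity yields RE by treating the
  two directions of an equivalence separately, and it yields H because each disjunct implies the
  disjunction. Conversely, if \<open>A \<^bold>\<longrightarrow> B\<close> is a theorem then \<open>B\<close> is equivalent to \<open>A \<^bold>\<or> B\<close>; H leads from
  \<open>\<^bold>\<box> A\<close> to \<open>\<^bold>\<box> (A \<^bold>\<or> B)\<close>, and RE from there to \<open>\<^bold>\<box> B\<close> (\<open>LP_box_mono\<close>). The remaining difference,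
  excluded middle under the operator for every formula rather than for the single formula \<open>\<^bold>\<top>\<close>,
  disappears because RE identifies all theorems (\<open>LP_box_theorem\<close>).

  The propositional axioms of the two systems may be different. Completeness makes every instance of
  a tautology a theorem (\<open>inst_derivable\<close>), and soundness makes every instance of an axiom an instance
  of a tautology (\<open>axiom_ptautology\<close>), so each system proves the propositional axioms of the other.
  Each direction is then an induction on derivations along a translation of formulas; the backward
  translation undoes \<open>nabla_to_box\<close>.
\<close>

section \<open>Classical reasoning in a calculus containing all tautologies\<close>

text \<open>Shared by both systems, so that each propositional step is justified by a truth table once.\<close>

locale classical_calculus =
  fixes Thm :: "'op form \<Rightarrow> bool"
  assumes taut: "ptautology P \<Longrightarrow> Thm (inst s P)"
    and mp: "Thm (A \<^bold>\<longrightarrow> B) \<Longrightarrow> Thm A \<Longrightarrow> Thm B"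
begin

lemma imp_weaken:
  assumes "Thm B"
  shows "Thm (A \<^bold>\<longrightarrow> B)"
proof -
  have "Thm (B \<^bold>\<longrightarrow> A \<^bold>\<longrightarrow> B)"
    using taut[of "PImp (PVar 0) (PImp (PVar 1) (PVar 0))" "\<lambda>i. [B, A] ! i"]
    by (simp add: ptautology_def)
  with assms show ?thesis by (blast intro: mp)
qed

lemma imp_refl: "Thm (A \<^bold>\<longrightarrow> A)"
  using taut[of "PImp (PVar 0) (PVar 0)" "\<lambda>_. A"] by (simp add: ptautology_def)

lemma imp_trans:
  assumes "Thm (A \<^bold>\<longrightarrow> B)" and "Thm (B \<^bold>\<longrightarrow> C)"
  shows "Thm (A \<^bold>\<longrightarrow> C)"
proof -
  have "Thm ((A \<^bold>\<longrightarrow> B) \<^bold>\<longrightarrow> (B \<^bold>\<longrightarrow> C) \<^bold>\<longrightarrow> A \<^bold>\<longrightarrow> C)"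
    using taut[of "PImp (PImp (PVar 0) (PVar 1))
        (PImp (PImp (PVar 1) (PVar 2)) (PImp (PVar 0) (PVar 2)))" "\<lambda>i. [A, B, C] ! i"]
    by (simp add: ptautology_def numeral_2_eq_2)
  with assms show ?thesis by (blast intro: mp)
qed

lemma conjI:
  assumes "Thm A" and "Thm B"
  shows "Thm (A \<^bold>\<and> B)"
proof -
  have "Thm (A \<^bold>\<longrightarrow> B \<^bold>\<longrightarrow> A \<^bold>\<and> B)"
    using taut[of "PImp (PVar 0) (PImp (PVar 1) (PConj (PVar 0) (PVar 1)))" "\<lambda>i. [A, B] ! i"]
    by (simp add: ptautology_def)
  with assms show ?thesis by (blast intro: mp)
qed

lemma conjunct1:
  assumes "Thm (A \<^bold>\<and> B)"
  shows "Thm A"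
proof -
  have "Thm (A \<^bold>\<and> B \<^bold>\<longrightarrow> A)"
    using taut[of "PImp (PConj (PVar 0) (PVar 1)) (PVar 0)" "\<lambda>i. [A, B] ! i"]
    by (simp add: ptautology_def)
  with assms show ?thesis by (blast intro: mp)
qed

lemma conjunct2:
  assumes "Thm (A \<^bold>\<and> B)"
  shows "Thm B"
proof -
  have "Thm (A \<^bold>\<and> B \<^bold>\<longrightarrow> B)"
    using taut[of "PImp (PConj (PVar 0) (PVar 1)) (PVar 1)" "\<lambda>i. [A, B] ! i"]
    by (simp add: ptautology_def)
  with assms show ?thesis by (blast intro: mp)
qed

lemma imp_disj1: "Thm (A \<^bold>\<longrightarrow> A \<^bold>\<or> B)"
  using taut[of "PImp (PVar 0) (PDisj (PVar 0) (PVar 1))" "\<lambda>i. [A, B] ! i"]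
  by (simp add: ptautology_def)

lemma imp_disj2: "Thm (B \<^bold>\<longrightarrow> A \<^bold>\<or> B)"
  using taut[of "PImp (PVar 1) (PDisj (PVar 0) (PVar 1))" "\<lambda>i. [A, B] ! i"]
  by (simp add: ptautology_def)

lemma disj_imp:
  assumes "Thm (A \<^bold>\<longrightarrow> C)" and "Thm (B \<^bold>\<longrightarrow> C)"
  shows "Thm (A \<^bold>\<or> B \<^bold>\<longrightarrow> C)"
proof -
  have "Thm ((A \<^bold>\<longrightarrow> C) \<^bold>\<longrightarrow> (B \<^bold>\<longrightarrow> C) \<^bold>\<longrightarrow> A \<^bold>\<or> B \<^bold>\<longrightarrow> C)"
    using taut[of "PImp (PImp (PVar 0) (PVar 2))
        (PImp (PImp (PVar 1) (PVar 2)) (PImp (PDisj (PVar 0) (PVar 1)) (PVar 2)))"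
        "\<lambda>i. [A, B, C] ! i"]
    by (simp add: ptautology_def numeral_2_eq_2)
  with assms show ?thesis by (blast intro: mp)
qed

lemma excluded_middle: "Thm (A \<^bold>\<or> \<^bold>\<not> A)"
  using taut[of "PDisj (PVar 0) (PNeg (PVar 0))" "\<lambda>_. A"] by (simp add: ptautology_def)

end


section \<open>Independence of the propositional axiomatization\<close>

lemma axiom_ptautology:
  assumes "complete_axiomatization Ax" and "S \<in> Ax"
  shows "ptautology S"
  using assms pderivable.Axiom[of S Ax PVar]
  by (simp add: complete_axiomatization_def psubst_PVar)

lemma inst_psubst: "inst s (psubst t S) = inst (\<lambda>i. inst s (t i)) S"
  by (induction S) auto

text \<open>
  An instance of a propositional derivation is again a derivation, since instances of instances of
  a schema are instances of it.
\<close>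

lemma inst_derivable:
  assumes axioms: "\<And>S s. S \<in> Ax \<Longrightarrow> Thm (inst s S)"
    and mp: "\<And>A B. Thm (A \<^bold>\<longrightarrow> B) \<Longrightarrow> Thm A \<Longrightarrow> Thm B"
    and "pderivable Ax P"
  shows "Thm (inst s P)"
  using assms(3)
proof induction
  case (Axiom S t)
  then show ?case by (simp add: inst_psubst axioms)
next
  case (MP A B)
  then show ?case using mp by simp
qed

lemma classical_calculus_L_nabla:
  assumes "complete_axiomatization Ax"
  shows "classical_calculus (L_nabla Ax)"
proof
  show "L_nabla Ax (inst s P)" if "ptautology P" for P s
  proof (rule inst_derivable[of Ax "L_nabla Ax", OF L_nabla.Prop L_nabla.MP])
    show "pderivable Ax P"
      using assms that by (simp add: complete_axiomatization_def)
  qed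
qed (rule L_nabla.MP)

lemma classical_calculus_LP_box:
  assumes "complete_axiomatization Ax"
  shows "classical_calculus (LP_box Ax)"
proof
  show "LP_box Ax (inst s P)" if "ptautology P" for P s
  proof (rule inst_derivable[of Ax "LP_box Ax", OF LP_box.Prop LP_box.MP])
    show "pderivable Ax P"
      using assms that by (simp add: complete_axiomatization_def)
  qed
qed (rule LP_box.MP)


section \<open>From the logic with \<open>\<^bold>\<nabla>\<close> to the logic with \<open>\<^bold>\<box>\<close>\<close>

lemma LP_box_mono:
  assumes "complete_axiomatization Ax" and "LP_box Ax (A \<^bold>\<longrightarrow> B)"
  shows "LP_box Ax (\<^bold>\<box> A \<^bold>\<longrightarrow> \<^bold>\<box> B)"
proof -
  interpret classical_calculus "LP_box Ax"
    using assms(1) by (rule classical_calculus_LP_box)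
  have "LP_box Ax (A \<^bold>\<or> B \<^bold>\<longleftrightarrow> B)"
    by (intro conjI disj_imp assms(2) imp_refl imp_disj2)
  then have "LP_box Ax (\<^bold>\<box> (A \<^bold>\<or> B) \<^bold>\<longrightarrow> \<^bold>\<box> B)"
    by (rule LP_box.RE[THEN conjunct1])
  moreover have "LP_box Ax (\<^bold>\<box> A \<^bold>\<longrightarrow> \<^bold>\<box> (A \<^bold>\<or> B))"
    by (rule imp_trans[OF imp_disj1 LP_box.H])
  ultimately show ?thesis by (rule imp_trans[rotated])
qed

text \<open>Every theorem is equivalent to \<open>\<^bold>\<top>\<close>, so the single axiom N gives necessitation.\<close>

lemma LP_box_theorem:
  assumes "complete_axiomatization Ax" and "LP_box Ax A"
  shows "LP_box Ax (\<^bold>\<box> A)"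
proof -
  interpret classical_calculus "LP_box Ax"
    using assms(1) by (rule classical_calculus_LP_box)
  have "LP_box Ax (\<^bold>\<box> \<^bold>\<top> \<^bold>\<longrightarrow> \<^bold>\<box> A)"
    using assms(1) imp_weaken[OF assms(2)] by (rule LP_box_mono)
  then show ?thesis using LP_box.N by (rule mp)
qed

lemma nabla_to_box_inst: "nabla_to_box (inst s S) = inst (\<lambda>i. nabla_to_box (s i)) S"
  by (induction S) auto

lemma L_nabla_imp_LP_box:
  assumes "complete_axiomatization Ax\<^sub>1" and "complete_axiomatization Ax\<^sub>2"
    and "L_nabla Ax\<^sub>1 A"
  shows "LP_box Ax\<^sub>2 (nabla_to_box A)"
proof -
  interpret classical_calculus "LP_box Ax\<^sub>2"
    using assms(2) by (rule classical_calculus_LP_box)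
  from assms(3) show ?thesis
  proof induction
    case (Prop S s)
    then show ?case
      by (simp add: nabla_to_box_inst taut axiom_ptautology[OF assms(1)])
  next
    case (Conj A B)
    show ?case by (simp add: LP_box.C)
  next
    case (ExMid A)
    show ?case by (simp add: LP_box_theorem[OF assms(2)] excluded_middle)
  next
    case (Refl A)
    show ?case by (simp add: LP_box.T)
  next
    case (MP A B)
    then show ?case using mp by simp
  next
    case (Mono A B)
    then show ?case by (simp add: LP_box_mono[OF assms(2)])
  qed
qed


section \<open>From the logic with \<open>\<^bold>\<box>\<close> to the logic with \<open>\<^bold>\<nabla>\<close>\<close>

abbreviation box_to_nabla :: "box_form \<Rightarrow> nabla_form" where
  "box_to_nabla \<equiv> map_form (\<lambda>_. Nabla)"

lemma box_to_nabla_nabla_to_box: "box_to_nabla (nabla_to_box A) = A"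
proof (induction A)
  case (Op x A)
  then show ?case by (cases x) simp
qed auto

lemma box_to_nabla_inst: "box_to_nabla (inst s S) = inst (\<lambda>i. box_to_nabla (s i)) S"
  by (induction S) auto

lemma LP_box_imp_L_nabla:
  assumes "complete_axiomatization Ax\<^sub>1" and "complete_axiomatization Ax\<^sub>2"
    and "LP_box Ax\<^sub>2 A"
  shows "L_nabla Ax\<^sub>1 (box_to_nabla A)"
proof -
  interpret classical_calculus "L_nabla Ax\<^sub>1"
    using assms(1) by (rule classical_calculus_L_nabla)
  from assms(3) show ?thesis
  proof induction
    case (Prop S s)
    then show ?case
      by (simp add: box_to_nabla_inst taut axiom_ptautology[OF assms(2)])
  next
    case (C A B)
    show ?case by (simp add: L_nabla.Conj)
  next
    case (H A B)
    show ?case by (simp add: disj_imp L_nabla.Mono imp_disj1 imp_disj2)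
  next
    case (T A)
    show ?case by (simp add: L_nabla.Refl)
  next
    case N
    show ?case by (simp add: L_nabla.ExMid)
  next
    case (MP A B)
    then show ?case using mp by simp
  next
    case (RE A B)
    then have "L_nabla Ax\<^sub>1 (box_to_nabla A \<^bold>\<longleftrightarrow> box_to_nabla B)"
      by simp
    then show ?case
      by (auto intro!: conjI L_nabla.Mono dest: conjunct1 conjunct2)
  qed
qed


section \<open>Deductive equivalence\<close>

theorem mainTheorem1:
  fixes Ax\<^sub>1 Ax\<^sub>2 :: "pform set" and A :: nabla_form
  assumes "complete_axiomatization Ax\<^sub>1"
    and "complete_axiomatization Ax\<^sub>2"
  shows "L_nabla Ax\<^sub>1 A \<longleftrightarrow> LP_box Ax\<^sub>2 (nabla_to_box A)"
  using L_nabla_imp_LP_box[OF assms] LP_box_imp_L_nabla[OF assms, of "nabla_to_box A"]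
  by (auto simp: box_to_nabla_nabla_to_box)

end
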